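(* Let $f:\mathbb{R}\mathrm{P}^2\to\mathbb{R}\mathrm{P}^2$ be a projective transformation that is not affine. Then $f$ maps precisely the circles of a hyperbolic pencil to circles; that is, there is a hyperbolic pencil of circles such that, for every circle $C\subset\mathbb{C}$ (of positive radius), the image $f(C)$ is a circle in $\mathbb{C}$ if and only if $C$ belongs to this pencil.
   Context: A projective transformation is a map $f:\mathbb{R}\mathrm{P}^2\to\mathbb{R}\mathrm{P}^2$, $[x]\mapsto[Ax]$ with $A\in \mathrm{GL}_3(\mathbb{R})$. The line at infinity is $\ell_\infty=\{[x] : x_3=0\}$, and $\mathbb{R}\mathrm{P}^2\setminus\ell_\infty$ is identified with the Euclidean plane $\mathbb{C}$ via $z=x+iy\leftrightarrow[(x,y,1)]$. The map $f$ is (real) affine if $f(\ell_\infty)=\ell_\infty$. A hyperbolic pencil of circles is a family of the following form: for two distinct points $p,q\in\mathbb{C}$ (the limit points), it consists of all level sets of $z\mapsto |z-p|/|z-q|\in[0,\infty]$. It contains the two degenerate (point) circles $\{p\},\{q\}$ and one straight line, the perpendicular bisector of $p$ and $q$; all other members are ordinary circles. *)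

theory Defs
  imports "HOL-Analysis.Analysis"
begin

definition proportional :: "real^3 \<Rightarrow> real^3 \<Rightarrow> bool" where
  "proportional x y \<longleftrightarrow> x \<noteq> 0 \<and> y \<noteq> 0 \<and> (\<exists>c. c \<noteq> 0 \<and> y = c *\<^sub>R x)"

(* proj_class x is the point [x]. The quotient is partial: proj_class 0 is an unspecified
   point, so every use of proj_class below is restricted to nonzero vectors. *)
quotient_type rp2 = "real^3" / partial: proportional
  morphisms rep_rp2 proj_class
proof (rule part_equivpI)
  have "(axis 1 1 :: real^3) \<noteq> 0"
    by simp
  then show "\<exists>x. proportional x x"
    unfolding proportional_def by (metis scaleR_one zero_neq_one)
  show "symp proportional"
  proof (rule sympI)
    fix x y assume "proportional x y"
    then obtain c where "x \<noteq> 0" "y \<noteq> 0" "c \<noteq> 0" "y = c *\<^sub>R x"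
      by (auto simp: proportional_def)
    moreover from this have "x = inverse c *\<^sub>R y"
      by simp
    ultimately show "proportional y x"
      unfolding proportional_def by (metis inverse_nonzero_iff_nonzero)
  qed
  show "transp proportional"
  proof (rule transpI)
    fix x y z assume "proportional x y" "proportional y z"
    then obtain c d where "x \<noteq> 0" "z \<noteq> 0" "c \<noteq> 0" "y = c *\<^sub>R x" "d \<noteq> 0" "z = d *\<^sub>R y"
      by (auto simp: proportional_def)
    moreover from this have "z = (d * c) *\<^sub>R x" "d * c \<noteq> 0"
      by simp_all
    ultimately show "proportional x z"
      unfolding proportional_def by blast
  qed
qed

lemma proj_class_eq_iff:
  assumes "x \<noteq> 0" "y \<noteq> 0"
  shows "proj_class x = proj_class y \<longleftrightarrow> (\<exists>c. c \<noteq> 0 \<and> y = c *\<^sub>R x)"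
proof -
  have refl: "proportional u u" if "u \<noteq> 0" for u
    using that unfolding proportional_def by (metis scaleR_one zero_neq_one)
  have "proportional x y \<longleftrightarrow> proj_class x = proj_class y"
    using Quotient3_rel[OF Quotient3_rp2, of x y] refl[OF assms(1)] refl[OF assms(2)] by blast
  then show ?thesis
    using assms by (auto simp: proportional_def)
qed

definition projective_transformation :: "(rp2 \<Rightarrow> rp2) \<Rightarrow> bool" where
  "projective_transformation f \<longleftrightarrow>
     (\<exists>A :: real^3^3. invertible A \<and> (\<forall>x. x \<noteq> 0 \<longrightarrow> f (proj_class x) = proj_class (A *v x)))"

definition line_at_infinity :: "rp2 set" where
  "line_at_infinity = {proj_class x | x. x \<noteq> 0 \<and> x $ 3 = 0}"

definition affine_transformation :: "(rp2 \<Rightarrow> rp2) \<Rightarrow> bool" where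
  "affine_transformation f \<longleftrightarrow>
     projective_transformation f \<and> f ` line_at_infinity = line_at_infinity"

definition plane_point :: "complex \<Rightarrow> rp2" where
  "plane_point z = proj_class (vector [Re z, Im z, 1])"

definition circle :: "complex set \<Rightarrow> bool" where
  "circle C \<longleftrightarrow> (\<exists>c r. r > 0 \<and> C = sphere c r)"

(* The ratio is taken in [0, \<infinity>]; as p \<noteq> q below, it has the value \<infinity> exactly at z = q
   (ennreal division satisfies a / 0 = \<infinity> for a \<noteq> 0). *)
definition distance_ratio :: "complex \<Rightarrow> complex \<Rightarrow> complex \<Rightarrow> ennreal" where
  "distance_ratio p q z = ennreal (cmod (z - p)) / ennreal (cmod (z - q))"

definition hyperbolic_pencil :: "complex set set \<Rightarrow> bool" where
  "hyperbolic_pencil P \<longleftrightarrow>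
     (\<exists>p q. p \<noteq> q \<and> P = {{z. distance_ratio p q z = t} | t. t \<in> {0..\<infinity>}})"

end

theory Submission
  imports Defs
begin

text \<open>
  Circles are the nondegenerate real conics with real points that pass through the two circular points \<open>I = (1, \<i>, 0)\<close> and
  \<open>J = (1, -\<i>, 0)\<close> of the complex projective plane. Hence \<open>f(C)\<close> can only be a circle if \<open>C\<close> passes
  through the complex conjugate points \<open>f\<inverse>(I)\<close> and \<open>f\<inverse>(J)\<close>, and the circles through two
  conjugate non-real points form a hyperbolic pencil.

  Concretely, let \<open>M\<close> be the inverse of a matrix of \<open>f\<close> and \<open>w = M I\<close>. As \<open>f\<close> is not
  affine, \<open>w\<^sub>3 \<noteq> 0\<close> (lemma \<open>not_affine_third_row\<close>), so the preimage of \<open>I\<close> is the finite point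
  \<open>(u\<^sub>1, u\<^sub>2) = (w\<^sub>1/w\<^sub>3, w\<^sub>2/w\<^sub>3)\<close>. The circle with centre \<open>c = c\<^sub>1 + \<i> c\<^sub>2\<close> and radius \<open>r\<close> passes
  through it iff \<open>(u\<^sub>1 - c\<^sub>1)\<^sup>2 + (u\<^sub>2 - c\<^sub>2)\<^sup>2 = r\<^sup>2\<close>. The left side factors into isotropic lines as
  \<open>(p - c) * cnj (q - c)\<close> with \<open>p = u\<^sub>1 + \<i> u\<^sub>2\<close> and \<open>q = cnj (u\<^sub>1 - \<i> u\<^sub>2)\<close>. The resulting equation
  \<open>(p - c) * cnj (q - c) = r\<^sup>2\<close> says that inversion in the circle exchanges \<open>p\<close> and \<open>q\<close>, which
  characterises the circles of Apollonius with limit points \<open>p\<close> and \<open>q\<close>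
  (lemma \<open>sphere_in_pencil_iff\<close>).

  Everything is carried out with real quadratic forms. That the form of \<open>C\<close>, transported
  by \<open>M\<close>, vanishes at \<open>I\<close> and \<open>J\<close> means that its coefficients at the squares of the first
  two coordinates agree and that the mixed coefficient of these coordinates is zero. Lemma
  \<open>image_is_circle_iff\<close> shows that this is equivalent to \<open>f(C)\<close> being a circle, and lemma
  \<open>circle_form_inverse_points\<close> combines the two real conditions into the complex equation above.
\<close>

section \<open>Circles of Apollonius and inverse points\<close>

lemma distance_ratio_eq_iff:
  assumes "p \<noteq> q" "t \<ge> 0"
  shows "distance_ratio p q z = ennreal t \<longleftrightarrow> cmod (z - p) = t * cmod (z - q)"
proof (cases "z = q")
  case True
  then show ?thesis
    using assms by (simp add: distance_ratio_def ennreal_divide_zero)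
next
  case False
  then have pos: "cmod (z - q) > 0" by simp
  have "distance_ratio p q z = ennreal (cmod (z - p) / cmod (z - q))"
    unfolding distance_ratio_def using pos by (simp add: divide_ennreal)
  then have "distance_ratio p q z = ennreal t \<longleftrightarrow> cmod (z - p) / cmod (z - q) = t"
    using \<open>t \<ge> 0\<close> by (simp only: ennreal_inj divide_nonneg_nonneg norm_ge_zero)
  then show ?thesis
    using pos by (simp add: nonzero_divide_eq_eq)
qed

lemma distance_ratio_eq_top_iff:
  assumes "p \<noteq> q"
  shows "distance_ratio p q z = top \<longleftrightarrow> z = q"
proof (cases "z = q")
  case True
  then show ?thesis
    using assms by (simp add: distance_ratio_def ennreal_divide_zero)
next
  case False
  then have pos: "cmod (z - q) > 0" by simp
  then show ?thesis
    unfolding distance_ratio_def using False by (simp add: divide_ennreal)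
qed

text \<open>
With the centre at the origin, the equation \<open>|v - a|\<^sup>2 = t\<^sup>2 |v - b|\<^sup>2\<close> holds at \<open>v\<close> and \<open>-v\<close>
  whenever \<open>|v| = r\<close>. Its odd part forces \<open>a = t\<^sup>2 b\<close>, and then its even part becomes
  \<open>(1 - t\<^sup>2) (r\<^sup>2 - t\<^sup>2 |b|\<^sup>2) = 0\<close>. Evaluating at the four points on the coordinate axes suffices.
\<close>
lemma sphere_level_set_imp_inverse_points:
  fixes c p q :: complex
  assumes "r > 0" "p \<noteq> q"
    and level: "\<And>z. z \<in> sphere c r \<Longrightarrow> cmod (z - p) = t * cmod (z - q)"
  shows "(p - c) * cnj (q - c) = of_real (r\<^sup>2)"
proof -
  define a where "a = p - c"
  define b where "b = q - c"
  have sq: "(cmod (v - a))\<^sup>2 = t\<^sup>2 * (cmod (v - b))\<^sup>2" if "cmod v = r" for v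
    using level[of "c + v"] that
    by (simp add: a_def b_def dist_norm power_mult_distrib algebra_simps)
  have e: "(x - Re a)\<^sup>2 + (y - Im a)\<^sup>2 = t\<^sup>2 * ((x - Re b)\<^sup>2 + (y - Im b)\<^sup>2)"
    if "x\<^sup>2 + y\<^sup>2 = r\<^sup>2" for x y
    using sq[of "Complex x y"] that \<open>r > 0\<close> by (simp add: cmod_power2 complex_norm)
  note e1 = e[of r 0, simplified] and e2 = e[of "-r" 0, simplified]
   and e3 = e[of 0 r, simplified] and e4 = e[of 0 "-r", simplified]
  have "4 * r * (Re a - t\<^sup>2 * Re b) = 0"
    using e1 e2 by algebra
  then have ra: "Re a = t\<^sup>2 * Re b" using \<open>r > 0\<close> by simp
  have "4 * r * (Im a - t\<^sup>2 * Im b) = 0"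
    using e3 e4 by algebra
  then have ia: "Im a = t\<^sup>2 * Im b" using \<open>r > 0\<close> by simp
  have "(1 - t\<^sup>2) * (r\<^sup>2 - t\<^sup>2 * ((Re b)\<^sup>2 + (Im b)\<^sup>2)) = 0"
    using e1 ra ia by algebra
  moreover have "t\<^sup>2 \<noteq> 1"
  proof
    assume "t\<^sup>2 = 1"
    then have "a = b" using ra ia by (simp add: complex_eq_iff)
    then show False using \<open>p \<noteq> q\<close> by (simp add: a_def b_def)
  qed
  ultimately have "r\<^sup>2 = t\<^sup>2 * ((Re b)\<^sup>2 + (Im b)\<^sup>2)" by simp
  then have "a * cnj b = of_real (r\<^sup>2)"
    by (simp add: complex_eq_iff ra ia algebra_simps power2_eq_square)
  then show ?thesis by (simp add: a_def b_def)
qed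

text \<open>
If \<open>a = p - c\<close> and \<open>b = q - c\<close> are inverse points, then \<open>a = t\<^sup>2 b\<close> with \<open>t = |a| / r\<close>, and
  \<open>|v - a|\<^sup>2 - t\<^sup>2 |v - b|\<^sup>2 = (1 - t\<^sup>2) (|v|\<^sup>2 - r\<^sup>2)\<close> identically in \<open>v\<close>. The case \<open>t = 1\<close>, the
  bisector, would give \<open>a = b\<close>.
\<close>
lemma inverse_points_imp_sphere_level_set:
  fixes c p q :: complex
  assumes "r > 0" "p \<noteq> q" and inv: "(p - c) * cnj (q - c) = of_real (r\<^sup>2)"
  shows "sphere c r = {z. cmod (z - p) = cmod (p - c) / r * cmod (z - q)}"
proof -
  define a where "a = p - c"
  define b where "b = q - c"
  define t where "t = cmod a / r"
  have ab: "a * cnj b = of_real (r\<^sup>2)" using inv by (simp add: a_def b_def)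
  then have "a \<noteq> 0" using \<open>r > 0\<close> by auto
  then have "t > 0" using \<open>r > 0\<close> by (simp add: t_def)
  have ta: "t\<^sup>2 * r\<^sup>2 = (cmod a)\<^sup>2" using \<open>r > 0\<close> by (simp add: t_def power_divide)
  have "cnj a * (of_real (t\<^sup>2) * b) = of_real (t\<^sup>2) * cnj (a * cnj b)" by simp
  also have "\<dots> = of_real (t\<^sup>2 * r\<^sup>2)" unfolding ab by simp
  also have "\<dots> = cnj a * a" unfolding ta by (metis complex_norm_square mult.commute)
  finally have "of_real (t\<^sup>2) * b = a" using \<open>a \<noteq> 0\<close> by simp
  then have a: "a = of_real (t\<^sup>2) * b" ..
  have ra: "Re a = t\<^sup>2 * Re b" and ia: "Im a = t\<^sup>2 * Im b"
    using arg_cong[OF a, of Re] arg_cong[OF a, of Im] by simp_all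
  have rr: "r\<^sup>2 = t\<^sup>2 * ((Re b)\<^sup>2 + (Im b)\<^sup>2)"
    using ab by (simp add: complex_eq_iff ra ia algebra_simps power2_eq_square)
  have "t\<^sup>2 \<noteq> 1"
  proof
    assume "t\<^sup>2 = 1"
    then have "a = b" using ra ia by (simp add: complex_eq_iff)
    then show False using \<open>p \<noteq> q\<close> by (simp add: a_def b_def)
  qed
  have "z \<in> sphere c r \<longleftrightarrow> cmod (z - p) = t * cmod (z - q)" for z
  proof -
    define v where "v = z - c"
    have za: "z - p = v - a" "z - q = v - b" by (simp_all add: v_def a_def b_def)
    have key: "(cmod (v - a))\<^sup>2 - (t * cmod (v - b))\<^sup>2 = (1 - t\<^sup>2) * ((cmod v)\<^sup>2 - r\<^sup>2)"
      unfolding power_mult_distrib cmod_power2 rr minus_complex.sel ra ia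
      by (simp add: power2_eq_square algebra_simps)
    have "z \<in> sphere c r \<longleftrightarrow> cmod v = r"
      by (simp add: v_def dist_norm norm_minus_commute)
    also have "\<dots> \<longleftrightarrow> (cmod v)\<^sup>2 = r\<^sup>2"
      using \<open>r > 0\<close> by (simp add: power2_eq_iff_nonneg)
    also have "\<dots> \<longleftrightarrow> (cmod (v - a))\<^sup>2 = (t * cmod (v - b))\<^sup>2"
      using key \<open>t\<^sup>2 \<noteq> 1\<close>
      by (metis (no_types, opaque_lifting) eq_iff_diff_eq_0 mult_eq_0_iff)
    also have "\<dots> \<longleftrightarrow> cmod (v - a) = t * cmod (v - b)"
      using \<open>t > 0\<close> by (subst power2_eq_iff_nonneg) auto
    finally show ?thesis by (simp add: za)
  qed
  then have "sphere c r = {z. cmod (z - p) = t * cmod (z - q)}" by blast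
  then show ?thesis by (simp only: t_def a_def)
qed

lemma sphere_in_pencil_iff:
  fixes c p q :: complex
  assumes "r > 0" "p \<noteq> q"
  shows "sphere c r \<in> {{z. distance_ratio p q z = t} | t. t \<in> {0..\<infinity>}} \<longleftrightarrow>
           (p - c) * cnj (q - c) = of_real (r\<^sup>2)"
proof
  assume "sphere c r \<in> {{z. distance_ratio p q z = t} | t. t \<in> {0..\<infinity>}}"
  then obtain t where S: "sphere c r = {z. distance_ratio p q z = t}" by blast
  \<comment> \<open>The level set of \<open>\<infinity>\<close> is the point \<open>q\<close>, whereas a sphere contains antipodal points.\<close>
  have "c + of_real r \<in> sphere c r" "c - of_real r \<in> sphere c r"
    using \<open>r > 0\<close> by (simp_all add: dist_norm)
  moreover have "c + of_real r \<noteq> c - of_real r"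
    using \<open>r > 0\<close> by (simp add: complex_eq_iff)
  ultimately have "t \<noteq> top"
    unfolding S mem_Collect_eq using distance_ratio_eq_top_iff[OF \<open>p \<noteq> q\<close>] by metis
  then obtain t' where "t' \<ge> 0" "t = ennreal t'" by (cases t) auto
  then show "(p - c) * cnj (q - c) = of_real (r\<^sup>2)"
    using sphere_level_set_imp_inverse_points[OF assms, of c t'] S
      distance_ratio_eq_iff[OF \<open>p \<noteq> q\<close>] by blast
next
  assume "(p - c) * cnj (q - c) = of_real (r\<^sup>2)"
  from inverse_points_imp_sphere_level_set[OF assms this]
  have "sphere c r = {z. distance_ratio p q z = ennreal (cmod (p - c) / r)}"
    using distance_ratio_eq_iff[OF \<open>p \<noteq> q\<close>] \<open>r > 0\<close> by simp
  then show "sphere c r \<in> {{z. distance_ratio p q z = t} | t. t \<in> {0..\<infinity>}}"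
    by fastforce
qed

section \<open>Circles as quadratic forms\<close>

definition circle_form :: "complex \<Rightarrow> real \<Rightarrow> real^3 \<Rightarrow> real" where
  "circle_form c r x = (x$1 - Re c * x$3)\<^sup>2 + (x$2 - Im c * x$3)\<^sup>2 - r\<^sup>2 * (x$3)\<^sup>2"

definition circle_polar :: "complex \<Rightarrow> real \<Rightarrow> real^3 \<Rightarrow> real^3 \<Rightarrow> real" where
  "circle_polar c r x y = (x$1 - Re c * x$3) * (y$1 - Re c * y$3)
     + (x$2 - Im c * x$3) * (y$2 - Im c * y$3) - r\<^sup>2 * (x$3) * (y$3)"

lemma vec3_eq_iff: "(x :: real^3) = y \<longleftrightarrow> x$1 = y$1 \<and> x$2 = y$2 \<and> x$3 = y$3"
  by (simp add: vec_eq_iff forall_3)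

lemma plane_point_sphere_iff:
  assumes "x \<noteq> 0" "r > 0"
  shows "proj_class x \<in> plane_point ` sphere c r \<longleftrightarrow> circle_form c r x = 0"
proof
  assume "proj_class x \<in> plane_point ` sphere c r"
  then obtain z where z: "z \<in> sphere c r" "proj_class (vector [Re z, Im z, 1]) = proj_class x"
    by (auto simp: plane_point_def)
  have "(vector [Re z, Im z, 1] :: real^3) \<noteq> 0" by (simp add: vec3_eq_iff)
  with z(2) assms obtain k where k: "x = k *\<^sub>R vector [Re z, Im z, 1]"
    using proj_class_eq_iff by blast
  have "dist c z = r" using z(1) by simp
  then have "(Re z - Re c)\<^sup>2 + (Im z - Im c)\<^sup>2 = r\<^sup>2"
    by (simp add: dist_norm norm_minus_commute[of c] flip: cmod_power2)
      (metis cmod_power2 minus_complex.sel)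
  then show "circle_form c r x = 0"
    unfolding circle_form_def k by simp algebra
next
  assume Q: "circle_form c r x = 0"
  have x3: "x$3 \<noteq> 0"
  proof
    assume "x$3 = 0"
    then show False using Q \<open>x \<noteq> 0\<close> by (simp add: circle_form_def vec3_eq_iff)
  qed
  define z where "z = Complex (x$1 / x$3) (x$2 / x$3)"
  have "x$1 = Re z * x$3" "x$2 = Im z * x$3"
    using x3 by (simp_all add: z_def)
  then have "circle_form c r x = ((Re z - Re c)\<^sup>2 + (Im z - Im c)\<^sup>2 - r\<^sup>2) * (x$3)\<^sup>2"
    unfolding circle_form_def by algebra
  then have "(Re z - Re c)\<^sup>2 + (Im z - Im c)\<^sup>2 = r\<^sup>2"
    using Q x3 by simp
  then have "(cmod (z - c))\<^sup>2 = r\<^sup>2" by (simp add: cmod_power2)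
  then have "z \<in> sphere c r"
    using \<open>r > 0\<close> by (simp add: dist_norm norm_minus_commute power2_eq_iff_nonneg)
  moreover have "plane_point z = proj_class x"
  proof -
    have "(vector [Re z, Im z, 1] :: real^3) \<noteq> 0" by (simp add: vec3_eq_iff)
    moreover have "x = x$3 *\<^sub>R vector [Re z, Im z, 1]"
      using x3 by (simp add: vec3_eq_iff z_def)
    ultimately show ?thesis
      unfolding plane_point_def using proj_class_eq_iff x3 \<open>x \<noteq> 0\<close> by blast
  qed
  ultimately show "proj_class x \<in> plane_point ` sphere c r" by force
qed

lemma plane_point_sphere_eq:
  assumes "r > 0"
  shows "plane_point ` sphere c r = {proj_class x | x. x \<noteq> 0 \<and> circle_form c r x = 0}"
proof -
  have "\<exists>x. x \<noteq> 0 \<and> X = proj_class x" if X: "X \<in> plane_point ` sphere c r" for X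
  proof -
    obtain z where z: "X = proj_class (vector [Re z, Im z, 1])"
      using X unfolding plane_point_def by blast
    have "(vector [Re z, Im z, 1] :: real^3) \<noteq> 0" by (simp add: vec3_eq_iff)
    then show ?thesis using z by blast
  qed
  then have "X \<in> plane_point ` sphere c r \<longleftrightarrow>
      (\<exists>x. X = proj_class x \<and> x \<noteq> 0 \<and> circle_form c r x = 0)" for X
    using plane_point_sphere_iff[OF _ assms] by metis
  then show ?thesis by (simp add: set_eq_iff)
qed

lemma circle_form_mult:
  fixes M :: "real^3^3"
  shows
  "circle_form c r (M *v y) =
     circle_form c r (column 1 M) * (y$1)\<^sup>2 + 2 * circle_polar c r (column 1 M) (column 2 M) * y$1 * y$2
     + circle_form c r (column 2 M) * (y$2)\<^sup>2
     + 2 * circle_polar c r (column 1 M) (column 3 M) * y$1 * y$3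
     + 2 * circle_polar c r (column 2 M) (column 3 M) * y$2 * y$3
     + circle_form c r (column 3 M) * (y$3)\<^sup>2"
  unfolding circle_form_def circle_polar_def
  by (simp add: matrix_vector_mult_def sum_3 column_def) algebra

text \<open>
Adding the values at the antipodal points \<open>m + v\<close> and \<open>m - v\<close> cancels the terms linear in \<open>v\<close>,
  so the leading form is constant on the vectors \<open>v\<close> of length \<open>s\<close>. A binary quadratic form
  that is constant on a circle about the origin is a multiple of \<open>x\<^sup>2 + y\<^sup>2\<close>.
\<close>
lemma quadratic_vanishing_on_sphere:
  fixes a b d e g h s :: real
  assumes "s > 0"
    and zero: "\<And>z. z \<in> sphere m s \<Longrightarrow>
      a * (Re z)\<^sup>2 + 2 * b * Re z * Im z + d * (Im z)\<^sup>2 + 2 * e * Re z + 2 * g * Im z + h = 0"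
  shows "a = d" "b = 0"
proof -
  define R where "R x y = a * x\<^sup>2 + 2 * b * x * y + d * y\<^sup>2 + 2 * e * x + 2 * g * y + h" for x y
  have R0: "R (Re m + x) (Im m + y) = 0" if "x\<^sup>2 + y\<^sup>2 = s\<^sup>2" for x y
  proof -
    have "cmod (Complex x y) = s" using that \<open>s > 0\<close> by (simp add: complex_norm)
    then have "m + Complex x y \<in> sphere m s" by (simp add: dist_norm)
    from zero[OF this] show ?thesis by (simp add: R_def)
  qed
  have two: "a * x\<^sup>2 + 2 * b * x * y + d * y\<^sup>2 = - R (Re m) (Im m)" if "x\<^sup>2 + y\<^sup>2 = s\<^sup>2" for x y
    using R0[of x y] R0[of "-x" "-y"] that unfolding R_def by (simp add: algebra_simps power2_eq_square)
  have "a * s\<^sup>2 = d * s\<^sup>2" using two[of s 0] two[of 0 s] by simp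
  then show "a = d" using \<open>s > 0\<close> by simp
  \<comment> \<open>A Pythagorean triple gives a point off the axes with rational coordinates relative to \<open>s\<close>.\<close>
  have "b * s\<^sup>2 = 0"
    using two[of s 0] two[of "3/5 * s" "4/5 * s"] \<open>a = d\<close>
    by (simp add: power2_eq_square)
  then show "b = 0" using \<open>s > 0\<close> by simp
qed

text \<open>
The hypotheses make the form a multiple of a sum of two squares on the span of \<open>X\<close> and
  \<open>Y\<close>. This plane contains a nonzero vector \<open>Z\<close> at infinity, and there every circle form is
  positive, which fixes the sign of the multiple.
\<close>
lemma circle_form_positive:
  assumes ind: "\<And>a b. a *\<^sub>R X + b *\<^sub>R Y = 0 \<Longrightarrow> a = 0 \<and> b = 0"
    and eq: "circle_form c r X = circle_form c r Y" and orth: "circle_polar c r X Y = 0"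
    and fin: "X$3 \<noteq> 0 \<or> Y$3 \<noteq> 0"
  shows "circle_form c r X > 0"
proof -
  define Z where "Z = Y$3 *\<^sub>R X + (- X$3) *\<^sub>R Y"
  have "Z \<noteq> 0" using ind[of "Y$3" "- X$3"] fin by (auto simp: Z_def)
  have Z3: "Z$3 = 0" by (simp add: Z_def)
  have "circle_form c r Z = (Y$3)\<^sup>2 * circle_form c r X + (X$3)\<^sup>2 * circle_form c r Y
          - 2 * X$3 * Y$3 * circle_polar c r X Y"
    unfolding circle_form_def circle_polar_def Z_def by simp algebra
  also have "\<dots> = ((Y$3)\<^sup>2 + (X$3)\<^sup>2) * circle_form c r X"
    using eq orth by (simp add: algebra_simps)
  finally have "((Y$3)\<^sup>2 + (X$3)\<^sup>2) * circle_form c r X = (Z$1)\<^sup>2 + (Z$2)\<^sup>2"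
    using Z3 by (simp add: circle_form_def)
  also have "\<dots> > 0" using \<open>Z \<noteq> 0\<close> Z3 by (simp add: vec3_eq_iff sum_power2_gt_zero_iff)
  finally show ?thesis by (simp add: zero_less_mult_iff sum_power2_gt_zero_iff not_sum_power2_lt_zero)
qed

section \<open>Circles whose projective image is a circle\<close>

lemma columns_independent:
  fixes A M :: "real^3^3"
  assumes "A ** M = mat 1" "a *\<^sub>R column 1 M + b *\<^sub>R column 2 M = 0"
  shows "a = 0 \<and> b = 0"
proof -
  have "M *v vector [a, b, 0] = 0"
    using assms(2) by (simp add: vec3_eq_iff matrix_vector_mult_def sum_3 column_def algebra_simps)
  then have "A *v (M *v vector [a, b, 0]) = 0"
    by (simp only: matrix_vector_mult_0_right)
  then have "(vector [a, b, 0] :: real^3) = 0"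
    by (simp only: matrix_vector_mul_assoc assms(1) matrix_vector_mul_lid)
  then show ?thesis by (simp add: vec3_eq_iff)
qed

text \<open>
The image of the circle is the zero set of the transported form \<open>y \<mapsto> circle_form c r (M *v y)\<close>,
  whose coefficients are the values of the form and of its polarisation at the columns of \<open>M\<close>.
  If this zero set is a circle, \<open>quadratic_vanishing_on_sphere\<close> gives the conditions on the leading
  coefficients. Conversely, under these conditions completing the squares turns the transported
  form into a positive multiple of \<open>(y\<^sub>1 - m\<^sub>1 y\<^sub>3)\<^sup>2 + (y\<^sub>2 - m\<^sub>2 y\<^sub>3)\<^sup>2 - \<sigma> y\<^sub>3\<^sup>2\<close>. Since
  the form of the given circle is negative at its centre, \<open>\<sigma> > 0\<close>, so the image is a circle of radius
  \<open>sqrt \<sigma>\<close>.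
\<close>
lemma image_is_circle_iff:
  fixes A M :: "real^3^3"
  assumes AM: "A ** M = mat 1" "M ** A = mat 1"
    and f: "\<And>x. x \<noteq> 0 \<Longrightarrow> f (proj_class x) = proj_class (A *v x)"
    and fin: "M$3$1 \<noteq> 0 \<or> M$3$2 \<noteq> 0"
    and "r > 0"
  shows "(\<exists>D. circle D \<and> f ` (plane_point ` sphere c r) = plane_point ` D) \<longleftrightarrow>
     circle_form c r (column 1 M) = circle_form c r (column 2 M) \<and>
     circle_polar c r (column 1 M) (column 2 M) = 0"
    (is "?L \<longleftrightarrow> ?R")
proof -
  have AMv: "A *v (M *v y) = y" "M *v (A *v y) = y" for y
    by (simp_all add: matrix_vector_mul_assoc AM)
  have nz: "A *v x \<noteq> 0" "M *v x \<noteq> 0" if "x \<noteq> 0" for x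
    using that AMv[of x] by (metis matrix_vector_mult_0_right)+
  have img: "f ` (plane_point ` sphere c r) = {proj_class y | y. y \<noteq> 0 \<and> circle_form c r (M *v y) = 0}"
  proof -
    have "f ` (plane_point ` sphere c r) = {proj_class (A *v x) | x. x \<noteq> 0 \<and> circle_form c r x = 0}"
      unfolding plane_point_sphere_eq[OF \<open>r > 0\<close>] using f by (auto simp: image_iff) metis+
    also have "\<dots> = {proj_class y | y. y \<noteq> 0 \<and> circle_form c r (M *v y) = 0}"
      using AMv nz by (auto; metis)
    finally show ?thesis .
  qed
  note expand = circle_form_mult[of c r M]
  show ?thesis
  proof
    assume ?L
    then obtain m s where s: "s > 0" "f ` (plane_point ` sphere c r) = plane_point ` sphere m s"
      by (auto simp: circle_def)
    have "circle_form c r (M *v vector [Re z, Im z, 1]) = 0" if z: "z \<in> sphere m s" for z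
    proof -
      have nzv: "(vector [Re z, Im z, 1] :: real^3) \<noteq> 0" by (simp add: vec3_eq_iff)
      have "plane_point z \<in> f ` (plane_point ` sphere c r)" unfolding s(2) using z by blast
      then obtain y where y: "y \<noteq> 0" "circle_form c r (M *v y) = 0"
        "proj_class (vector [Re z, Im z, 1]) = proj_class y"
        unfolding img plane_point_def by blast
      then obtain k where k: "k \<noteq> 0" "y = k *\<^sub>R vector [Re z, Im z, 1]"
        using proj_class_eq_iff[OF nzv] by blast
      have "circle_form c r (M *v y) = k\<^sup>2 * circle_form c r (M *v vector [Re z, Im z, 1])"
        unfolding k expand by simp algebra
      then show ?thesis using y k by simp
    qed
    then have "circle_form c r (column 1 M) * (Re z)\<^sup>2
        + 2 * circle_polar c r (column 1 M) (column 2 M) * Re z * Im z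
        + circle_form c r (column 2 M) * (Im z)\<^sup>2
        + 2 * circle_polar c r (column 1 M) (column 3 M) * Re z
        + 2 * circle_polar c r (column 2 M) (column 3 M) * Im z
        + circle_form c r (column 3 M) = 0" if "z \<in> sphere m s" for z
      using that unfolding expand by simp
    from quadratic_vanishing_on_sphere[OF \<open>s > 0\<close> this] show ?R by blast
  next
    assume R: ?R
    define a where "a = circle_form c r (column 1 M)"
    define e where "e = circle_polar c r (column 1 M) (column 3 M)"
    define g where "g = circle_polar c r (column 2 M) (column 3 M)"
    define h where "h = circle_form c r (column 3 M)"
    have "a > 0" unfolding a_def
    proof (rule circle_form_positive)
      show "u = 0 \<and> v = 0" if "u *\<^sub>R column 1 M + v *\<^sub>R column 2 M = 0" for u v
        using that by (rule columns_independent[OF AM(1)])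
      show "column 1 M $ 3 \<noteq> 0 \<or> column 2 M $ 3 \<noteq> 0" using fin by (simp add: column_def)
    qed (use R in auto)
    define m where "m = Complex (- e / a) (- g / a)"
    define s2 where "s2 = (e\<^sup>2 + g\<^sup>2) / a\<^sup>2 - h / a"
    have form: "circle_form c r (M *v y) =
        a * ((y$1 - Re m * y$3)\<^sup>2 + (y$2 - Im m * y$3)\<^sup>2 - s2 * (y$3)\<^sup>2)" for y
    proof -
      have "circle_form c r (M *v y) = a * (y$1)\<^sup>2 + a * (y$2)\<^sup>2 + 2 * e * y$1 * y$3
           + 2 * g * y$2 * y$3 + h * (y$3)\<^sup>2"
        unfolding expand using R by (simp add: a_def e_def g_def h_def)
      also have "\<dots> = a * ((y$1 - Re m * y$3)\<^sup>2 + (y$2 - Im m * y$3)\<^sup>2 - s2 * (y$3)\<^sup>2)"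
        using \<open>a > 0\<close> by (simp add: m_def s2_def field_simps power2_eq_square)
      finally show ?thesis .
    qed
    have "s2 > 0"
    proof (rule ccontr)
      assume "\<not> s2 > 0"
      then have "s2 * t\<^sup>2 \<le> 0" for t by (simp add: mult_nonpos_nonneg)
      then have "circle_form c r (M *v y) \<ge> 0" for y
        unfolding form using \<open>a > 0\<close> by (smt (verit) mult_nonneg_nonneg zero_le_power2)
      then have "circle_form c r x \<ge> 0" for x using AMv(2)[of x] by metis
      \<comment> \<open>At the centre of the circle the form has the value \<open>- r\<^sup>2\<close>.\<close>
      from this[of "vector [Re c, Im c, 1]"] show False
        using \<open>r > 0\<close> by (simp add: circle_form_def)
    qed
    then have form': "circle_form c r (M *v y) = a * circle_form m (sqrt s2) y" for y
      unfolding form by (simp add: circle_form_def)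
    have "f ` (plane_point ` sphere c r) = plane_point ` sphere m (sqrt s2)"
      unfolding img using \<open>s2 > 0\<close> \<open>a > 0\<close> by (simp add: plane_point_sphere_eq form')
    moreover have "circle (sphere m (sqrt s2))"
      unfolding circle_def using \<open>s2 > 0\<close> real_sqrt_gt_zero by blast
    ultimately show ?L by blast
  qed
qed

text \<open>
Otherwise the third coordinate of \<open>M y\<close> is a multiple of that of \<open>y\<close>, with a nonzero factor because
  \<open>M\<close> is invertible, so that \<open>f\<close> preserves the line at infinity.
\<close>
lemma not_affine_third_row:
  fixes A M :: "real^3^3"
  assumes AM: "A ** M = mat 1" "M ** A = mat 1"
    and f: "\<And>x. x \<noteq> 0 \<Longrightarrow> f (proj_class x) = proj_class (A *v x)"
    and "projective_transformation f" and "\<not> affine_transformation f"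
  shows "M$3$1 \<noteq> 0 \<or> M$3$2 \<noteq> 0"
proof (rule ccontr)
  assume "\<not> ?thesis"
  then have M3: "(M *v y)$3 = M$3$3 * y$3" for y
    by (simp add: matrix_vector_mult_def sum_3)
  have AMv: "A *v (M *v y) = y" "M *v (A *v y) = y" for y
    by (simp_all add: matrix_vector_mul_assoc AM)
  have nz: "A *v x \<noteq> 0" "M *v x \<noteq> 0" if "x \<noteq> 0" for x
    using that AMv[of x] by (metis matrix_vector_mult_0_right)+
  have "M$3$3 \<noteq> 0"
    using M3[of "A *v vector [0, 0, 1]"] by (auto simp: AMv)
  then have A3: "(A *v x)$3 = 0 \<longleftrightarrow> x$3 = 0" for x
    using M3[of "A *v x"] by (simp add: AMv)
  have "f ` line_at_infinity = {proj_class (A *v x) | x. x \<noteq> 0 \<and> x$3 = 0}"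
    unfolding line_at_infinity_def using f by (auto simp: image_iff) metis+
  also have "\<dots> = line_at_infinity"
    unfolding line_at_infinity_def using AMv nz A3 by (auto; metis)
  finally show False using assms by (simp add: affine_transformation_def)
qed

section \<open>The limit points of the pencil\<close>

text \<open>
The two real conditions are the real and imaginary parts of the statement that the complexified
  circle form vanishes at \<open>w = X + \<i> Y\<close>. Over the complex numbers the sum of two squares
  in this form is a product of two linear factors; dividing by \<open>(w 3)\<^sup>2\<close> turns them into
  \<open>p - c\<close> and \<open>cnj (q - c)\<close>.
\<close>
lemma circle_form_inverse_points:
  fixes X Y :: "real^3"
  defines "w \<equiv> \<lambda>i. Complex (X$i) (Y$i)"
  assumes "w 3 \<noteq> 0"
  shows "circle_form c r X = circle_form c r Y \<and> circle_polar c r X Y = 0 \<longleftrightarrow>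
     ((w 1 + \<i> * w 2) / w 3 - c) * cnj (cnj ((w 1 - \<i> * w 2) / w 3) - c) = of_real (r\<^sup>2)"
proof -
  have "circle_form c r X = circle_form c r Y \<and> circle_polar c r X Y = 0 \<longleftrightarrow>
     (w 1 + \<i> * w 2 - c * w 3) * (w 1 - \<i> * w 2 - cnj c * w 3) - of_real (r\<^sup>2) * (w 3)\<^sup>2 = 0"
  proof -
    define T where "T = (w 1 + \<i> * w 2 - c * w 3) * (w 1 - \<i> * w 2 - cnj c * w 3)
      - of_real (r\<^sup>2) * (w 3)\<^sup>2"
    have "Re T = circle_form c r X - circle_form c r Y" "Im T = 2 * circle_polar c r X Y"
      by (simp_all add: T_def w_def circle_form_def circle_polar_def power2_eq_square algebra_simps)
    then show ?thesis unfolding T_def[symmetric] by (auto simp: complex_eq_iff)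
  qed
  also have "\<dots> \<longleftrightarrow> ((w 1 + \<i> * w 2) / w 3 - c) * ((w 1 - \<i> * w 2) / w 3 - cnj c) = of_real (r\<^sup>2)"
    using assms(2) by (simp add: field_simps power2_eq_square)
  finally show ?thesis by simp
qed

text \<open>
The two points coincide only if both \<open>w 1 / w 3\<close> and \<open>w 2 / w 3\<close> are real. Then \<open>w\<close> is a complex
  multiple of a real vector, and its real part \<open>X\<close> and imaginary part \<open>Y\<close> are proportional.
\<close>
lemma limit_points_distinct:
  fixes X Y :: "real^3"
  defines "w \<equiv> \<lambda>i. Complex (X$i) (Y$i)"
  assumes ind: "\<And>a b. a *\<^sub>R X + b *\<^sub>R Y = 0 \<Longrightarrow> a = 0 \<and> b = 0" and w3: "w 3 \<noteq> 0"
  shows "(w 1 + \<i> * w 2) / w 3 \<noteq> cnj ((w 1 - \<i> * w 2) / w 3)"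
proof
  assume eq: "(w 1 + \<i> * w 2) / w 3 = cnj ((w 1 - \<i> * w 2) / w 3)"
  define u where "u = w 1 / w 3"
  define v where "v = w 2 / w 3"
  have "u + \<i> * v = cnj u + \<i> * cnj v"
    using eq by (simp add: u_def v_def add_divide_distrib diff_divide_distrib)
  then have "Im u = 0" "Im v = 0" by (simp_all add: complex_eq_iff)
  then have "u = of_real (Re u)" "v = of_real (Re v)" by (simp_all add: complex_eq_iff)
  then have "w 1 = of_real (Re u) * w 3" "w 2 = of_real (Re v) * w 3"
    using w3 by (simp_all add: u_def v_def field_simps)
  then have "Y$3 *\<^sub>R X + (- X$3) *\<^sub>R Y = 0"
    by (simp add: vec3_eq_iff w_def complex_eq_iff)
  from ind[OF this] show False using w3 by (simp add: w_def complex_eq_iff)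
qed

theorem theorem3p4:
  fixes f :: "rp2 \<Rightarrow> rp2"
  assumes "projective_transformation f"
    and "\<not> affine_transformation f"
  shows "\<exists>P. hyperbolic_pencil P \<and>
           (\<forall>C. circle C \<longrightarrow>
              ((\<exists>D. circle D \<and> f ` (plane_point ` C) = plane_point ` D) \<longleftrightarrow> C \<in> P))"
proof -
  obtain A :: "real^3^3" where A: "invertible A"
    and f: "\<And>x. x \<noteq> 0 \<Longrightarrow> f (proj_class x) = proj_class (A *v x)"
    using assms(1) by (auto simp: projective_transformation_def)
  obtain M where AM: "A ** M = mat 1" "M ** A = mat 1"
    using A by (auto simp: invertible_def)
  have fin: "M$3$1 \<noteq> 0 \<or> M$3$2 \<noteq> 0"
    using not_affine_third_row[OF AM f assms] .
  \<comment> \<open>\<open>(w 1, w 2, w 3)\<close> represents the preimage under \<open>f\<close> of the circular point \<open>(1, \<i>, 0)\<close>.\<close>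
  define w where "w i = Complex (column 1 M $ i) (column 2 M $ i)" for i
  have w3: "w 3 \<noteq> 0" using fin by (simp add: w_def column_def complex_eq_iff)
  define p where "p = (w 1 + \<i> * w 2) / w 3"
  define q where "q = cnj ((w 1 - \<i> * w 2) / w 3)"
  define P where "P = {{z. distance_ratio p q z = t} | t. t \<in> {0..\<infinity>}}"
  have "p \<noteq> q"
    unfolding p_def q_def w_def
    by (rule limit_points_distinct[OF columns_independent[OF AM(1)] w3[unfolded w_def]])
  then have "hyperbolic_pencil P"
    unfolding hyperbolic_pencil_def P_def by blast
  moreover have "(\<exists>D. circle D \<and> f ` (plane_point ` C) = plane_point ` D) \<longleftrightarrow> C \<in> P"
    if C: "circle C" for C
  proof -
    obtain c r where "r > 0" and C: "C = sphere c r" using C by (auto simp: circle_def)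
    have "(\<exists>D. circle D \<and> f ` (plane_point ` C) = plane_point ` D) \<longleftrightarrow>
       circle_form c r (column 1 M) = circle_form c r (column 2 M) \<and>
       circle_polar c r (column 1 M) (column 2 M) = 0"
      unfolding C using image_is_circle_iff[OF AM f fin \<open>r > 0\<close>] .
    also have "\<dots> \<longleftrightarrow> (p - c) * cnj (q - c) = of_real (r\<^sup>2)"
      unfolding p_def q_def w_def
      by (rule circle_form_inverse_points[OF w3[unfolded w_def]])
    also have "\<dots> \<longleftrightarrow> C \<in> P"
      unfolding C P_def using sphere_in_pencil_iff[OF \<open>r > 0\<close> \<open>p \<noteq> q\<close>] ..
    finally show ?thesis .
  qed
  ultimately show ?thesis by blast
qed

end
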